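(* For each regular cardinal $\kappa$, there is a ccc Tychonoff space $X$ of cardinality $\kappa$ and countable pseudocharacter such that no uncountable subspace $Y\subseteq X$ with $|Y|<\kappa$ is ccc (in the subspace topology).
   Context: A topological space $(X,\tau)$ is ccc (has the countable chain condition) if for any uncountable $\mathcal{F}\subseteq\tau$ there are distinct $U,V\in\mathcal{F}$ with $U\cap V\neq\emptyset$. Regular cardinals are infinite by convention. A space has countable pseudocharacter if for every point $p$, the singleton $\{p\}$ is the intersection of countably many open sets. Tychonoff means completely regular and Hausdorff. *)

theory Defs
  imports "HOL-Analysis.Analysis"
begin

unbundle cardinal_syntax

definition ccc_space :: "'a topology \<Rightarrow> bool"
  where "ccc_space X \<longleftrightarrow>
    (\<forall>\<F>. (\<forall>U\<in>\<F>. openin X U) \<and> uncountable \<F> \<longrightarrow>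
          (\<exists>U\<in>\<F>. \<exists>V\<in>\<F>. U \<noteq> V \<and> U \<inter> V \<noteq> {}))"

definition tychonoff_space :: "'a topology \<Rightarrow> bool"
  where "tychonoff_space X \<longleftrightarrow> completely_regular_space X \<and> Hausdorff_space X"

definition countable_pseudocharacter :: "'a topology \<Rightarrow> bool"
  where "countable_pseudocharacter X \<longleftrightarrow> (\<forall>p\<in>topspace X. gdelta_in X {p})"

(* Includes the convention that regular cardinals are infinite; regularCard alone
   does not imply it. *)
definition regular_cardinal :: "'k rel \<Rightarrow> bool"
  where "regular_cardinal \<kappa> \<longleftrightarrow> Card_order \<kappa> \<and> cinfinite \<kappa> \<and> regularCard \<kappa>"

end

theory Submission
  imports Defs
begin

text \<open>
  Let \<open>K\<close> be the field of \<open>\<kappa>\<close>. The space is a dense subspace of a power of the two-point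
  space, indexed by the elements of \<open>K\<close>, which is built so that every set in a prescribed family
  \<open>\<S>\<close> is closed and discrete.

  The coordinates are the pairs \<open>(\<alpha>, S)\<close> with \<open>\<alpha> \<in> K\<close> and \<open>S \<in> \<S>\<close>. Coordinate \<open>(\<alpha>, S)\<close> takes
  the value 1 at the point \<open>\<alpha>\<close> and the value 0 at all other points of \<open>S\<close>, so it gives a clopen
  set that contains \<open>\<alpha>\<close> and meets \<open>S\<close> in at most \<open>\<alpha>\<close>. At the points outside \<open>S\<close> and different from
  \<open>\<alpha>\<close> its value is free. A finite condition mentions only finitely many \<open>\<alpha>\<close> and \<open>S\<close>, and the
  points which they do not cover can be used to satisfy it. As long as finitely many members of
  \<open>\<S>\<close> and finitely many points always leave enough room, the free values can therefore be chosen so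
  that the space is dense in the full power, and then it inherits the countable chain condition
  (\<open>ccc_isolating_topology\<close>).

  The family \<open>\<S>\<close> consists of all initial segments of \<open>K\<close> together with the pieces of a partition
  of \<open>K\<close> into countably many large sets \<open>D n\<close>. The two kinds of sets serve different purposes.
  By regularity every \<open>Y\<close> with \<open>|Y| <o \<kappa>\<close> lies in an initial segment, so it is discrete, and
  an uncountable discrete space is not ccc (\<open>not_ccc_isolating_subspace\<close>). A space that is a
  countable union of closed discrete sets has countable pseudocharacter
  (\<open>countable_pseudocharacter_isolating_topology\<close>).

  There is enough room: finitely many initial segments have size below \<open>\<kappa>\<close>, finitely many
  \<open>D n\<close> miss another piece of the partition, and each possible pattern of free values can be
  assigned to \<open>\<kappa>\<close> many points of each piece (\<open>regular_rich_family\<close>).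
\<close>

section \<open>Subspaces of powers of the two-point space\<close>

definition cell :: "'a set \<Rightarrow> ('a \<Rightarrow> 'i set) \<Rightarrow> 'i set \<Rightarrow> 'a \<Rightarrow> 'a set"
  where "cell K s F x = {y\<in>K. s y \<inter> F = s x \<inter> F}"

text \<open>
  This is the initial topology of \<open>x \<mapsto> s x \<inter> I\<close> into the power set of \<open>I\<close>, identified with the
  product of \<open>I\<close> many two-point discrete spaces; the cells are the traces of the basic open sets.
  Defining it on \<open>K\<close> itself keeps the points in the type of the cardinal.
\<close>
definition code_topology :: "'a set \<Rightarrow> ('a \<Rightarrow> 'i set) \<Rightarrow> 'i set \<Rightarrow> 'a topology"
  where "code_topology K s I =
    topology (\<lambda>U. U \<subseteq> K \<and> (\<forall>x\<in>U. \<exists>F\<in>Fpow I. cell K s F x \<subseteq> U))"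

lemma openin_code_topology:
  "openin (code_topology K s I) U \<longleftrightarrow> U \<subseteq> K \<and> (\<forall>x\<in>U. \<exists>F\<in>Fpow I. cell K s F x \<subseteq> U)"
proof -
  have "istopology (\<lambda>U. U \<subseteq> K \<and> (\<forall>x\<in>U. \<exists>F\<in>Fpow I. cell K s F x \<subseteq> U))"
    unfolding istopology_def
  proof (intro conjI allI impI)
    fix U V
    assume U: "U \<subseteq> K \<and> (\<forall>x\<in>U. \<exists>F\<in>Fpow I. cell K s F x \<subseteq> U)"
      and V: "V \<subseteq> K \<and> (\<forall>x\<in>V. \<exists>F\<in>Fpow I. cell K s F x \<subseteq> V)"
    show "U \<inter> V \<subseteq> K" using U by blast
    show "\<forall>x\<in>U \<inter> V. \<exists>F\<in>Fpow I. cell K s F x \<subseteq> U \<inter> V"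
    proof
      fix x assume "x \<in> U \<inter> V"
      then obtain F G where "F \<in> Fpow I" "cell K s F x \<subseteq> U" "G \<in> Fpow I" "cell K s G x \<subseteq> V"
        using U V by blast
      moreover from this have "F \<union> G \<in> Fpow I" by (auto simp: Fpow_def)
      moreover have "cell K s (F \<union> G) x \<subseteq> cell K s F x \<inter> cell K s G x"
        unfolding cell_def by blast
      ultimately show "\<exists>F\<in>Fpow I. cell K s F x \<subseteq> U \<inter> V" by blast
    qed
  next
    fix \<U>
    assume "\<forall>U\<in>\<U>. U \<subseteq> K \<and> (\<forall>x\<in>U. \<exists>F\<in>Fpow I. cell K s F x \<subseteq> U)"
    then show "\<Union>\<U> \<subseteq> K" and "\<forall>x\<in>\<Union>\<U>. \<exists>F\<in>Fpow I. cell K s F x \<subseteq> \<Union>\<U>"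
      by (blast, meson Union_iff Union_upper order_trans)
  qed
  then show ?thesis
    by (simp add: code_topology_def topology_inverse')
qed

text \<open>
  For a fixed \<open>F\<close> the cells partition \<open>K\<close>, so any union of them is clopen. This is the source of
  all clopen sets below.
\<close>
lemma openin_code_topology_if_union_of_cells:
  assumes "F \<in> Fpow I" "U \<subseteq> K" "\<And>x. x \<in> U \<Longrightarrow> cell K s F x \<subseteq> U"
  shows "openin (code_topology K s I) U"
  using assms unfolding openin_code_topology by blast

lemma openin_coordinate:
  "i \<in> I \<Longrightarrow> openin (code_topology K s I) {y\<in>K. i \<in> s y}"
  "i \<in> I \<Longrightarrow> openin (code_topology K s I) {y\<in>K. i \<notin> s y}"
  by (rule openin_code_topology_if_union_of_cells[of "{i}"]; auto simp: cell_def Fpow_def)+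

lemma topspace_code_topology [simp]: "topspace (code_topology K s I) = K"
proof
  show "topspace (code_topology K s I) \<subseteq> K"
    using openin_topspace[of "code_topology K s I"] by (simp only: openin_code_topology)
  have "openin (code_topology K s I) K"
    by (rule openin_code_topology_if_union_of_cells[of "{}"]) (auto simp: cell_def Fpow_def)
  then show "K \<subseteq> topspace (code_topology K s I)"
    by (rule openin_subset)
qed

lemma completely_regular_code_topology: "completely_regular_space (code_topology K s I)"
  unfolding completely_regular_space_def
proof (intro allI impI)
  let ?X = "code_topology K s I"
  fix C x
  assume "closedin ?X C \<and> x \<in> topspace ?X - C"
  then have "openin ?X (K - C)" "x \<in> K - C" and C: "C \<subseteq> K"
    by (auto simp: closedin_def)
  then obtain F where F: "F \<in> Fpow I" and sub: "cell K s F x \<subseteq> K - C"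
    unfolding openin_code_topology by blast
  \<comment> \<open>A function that is constant on the cells of one fixed \<open>F\<close> is continuous.\<close>
  let ?f = "\<lambda>y. if y \<in> cell K s F x then 0 else 1 :: real"
  have "openin ?X {y\<in>K. ?f y \<in> U}" for U :: "real set"
  proof (rule openin_code_topology_if_union_of_cells[OF F])
    show "cell K s F y \<subseteq> {y\<in>K. ?f y \<in> U}" if "y \<in> {y\<in>K. ?f y \<in> U}" for y
      using that by (clarsimp simp: cell_def split: if_splits)
  qed auto
  then have "continuous_map ?X (top_of_set {0..1}) ?f"
    by (auto simp: continuous_map_in_subtopology continuous_map_def)
  moreover have "?f x = 0" "?f ` C \<subseteq> {1}"
    using \<open>x \<in> K - C\<close> sub by (auto simp: cell_def)
  ultimately show "\<exists>f. continuous_map ?X (top_of_set {0..1::real}) f \<and> f x = 0 \<and> f ` C \<subseteq> {1}"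
    by blast
qed

section \<open>The countable chain condition\<close>

lemma card_Pow_constrained:
  assumes "finite W" "F \<subseteq> W"
  shows "2 ^ (card W - card F) \<le> card {G \<in> Pow W. G \<inter> F = A \<inter> F}"
proof -
  have "inj_on (\<lambda>T. T \<union> (A \<inter> F)) (Pow (W - F))"
    by (rule inj_onI) blast
  moreover have "(\<lambda>T. T \<union> (A \<inter> F)) ` Pow (W - F) \<subseteq> {G \<in> Pow W. G \<inter> F = A \<inter> F}"
    using assms by auto
  ultimately have "card (Pow (W - F)) \<le> card {G \<in> Pow W. G \<inter> F = A \<inter> F}"
    by (rule card_inj_on_le) (use assms in simp)
  then show ?thesis
    using assms by (simp add: card_Pow card_Diff_subset finite_subset)
qed

text \<open>
  A finite condition \<open>(F U, A U)\<close> prescribes the trace on \<open>F U\<close>. Among the subsets of a large finite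
  set, a condition on \<open>n\<close> coordinates is met by a fraction of \<open>1/2^n\<close>. Pairwise incompatible
  conditions are met by disjoint collections of subsets, so there are at most \<open>2^n\<close> of them.
\<close>
lemma card_incompatible_le:
  assumes "finite \<V>" and fin: "\<And>U. U \<in> \<V> \<Longrightarrow> finite (F U) \<and> card (F U) = n"
    and disj: "\<And>U V G. U \<in> \<V> \<Longrightarrow> V \<in> \<V> \<Longrightarrow> G \<subseteq> (\<Union>U\<in>\<V>. F U) \<Longrightarrow>
      G \<inter> F U = A U \<inter> F U \<Longrightarrow> G \<inter> F V = A V \<inter> F V \<Longrightarrow> U = V"
  shows "card \<V> \<le> 2 ^ n"
proof (cases "\<V> = {}")
  case False
  let ?W = "\<Union>U\<in>\<V>. F U"
  let ?E = "\<lambda>U. {G \<in> Pow ?W. G \<inter> F U = A U \<inter> F U}"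
  have W: "finite ?W" using assms by blast
  have "n \<le> card ?W"
    using False fin W by (metis UN_upper card_mono ex_in_conv)
  have "card \<V> * 2 ^ (card ?W - n) = (\<Sum>U\<in>\<V>. 2 ^ (card ?W - n))" by simp
  also have "\<dots> \<le> (\<Sum>U\<in>\<V>. card (?E U))"
  proof (rule sum_mono)
    fix U assume U: "U \<in> \<V>"
    then have "F U \<subseteq> ?W" by blast
    from card_Pow_constrained[OF W this, of "A U"] show "2 ^ (card ?W - n) \<le> card (?E U)"
      using fin[OF U] by simp
  qed
  also have "\<dots> = card (\<Union>U\<in>\<V>. ?E U)"
  proof (rule card_UN_disjoint[symmetric])
    show "\<forall>U\<in>\<V>. \<forall>V\<in>\<V>. U \<noteq> V \<longrightarrow> ?E U \<inter> ?E V = {}"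
      using disj by blast
    show "\<forall>U\<in>\<V>. finite (?E U)"
      using W by simp
  qed (rule assms(1))
  also have "\<dots> \<le> card (Pow ?W)"
    by (rule card_mono) (use W in auto)
  also have "\<dots> = 2 ^ n * 2 ^ (card ?W - n)"
    using W \<open>n \<le> card ?W\<close> by (simp add: card_Pow flip: power_add)
  finally show ?thesis by simp
qed simp

text \<open>
  The hypothesis says that the codes are dense in the power set of \<open>I\<close>. Density turns disjointness
  of cells into incompatibility of conditions. Hence in a disjoint family only finitely many
  members have their chosen cell given by a condition on \<open>n\<close> coordinates, for each \<open>n\<close>.
\<close>
lemma ccc_code_topology:
  assumes indep: "\<And>F G. F \<in> Fpow I \<Longrightarrow> G \<subseteq> F \<Longrightarrow> \<exists>y\<in>K. s y \<inter> F = G"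
  shows "ccc_space (code_topology K s I)"
  unfolding ccc_space_def
proof (intro allI impI, rule ccontr)
  fix \<F>
  assume \<F>: "(\<forall>U\<in>\<F>. openin (code_topology K s I) U) \<and> uncountable \<F>"
    and no: "\<not> (\<exists>U\<in>\<F>. \<exists>V\<in>\<F>. U \<noteq> V \<and> U \<inter> V \<noteq> {})"
  then have op: "\<forall>U\<in>\<F>. openin (code_topology K s I) U" and unc: "uncountable \<F>"
    by auto
  have "\<forall>U\<in>\<F> - {{}}. \<exists>x F. F \<in> Fpow I \<and> cell K s F x \<subseteq> U"
    using op unfolding openin_code_topology by blast
  from bchoice[OF this] obtain x
    where "\<forall>U\<in>\<F> - {{}}. \<exists>F. F \<in> Fpow I \<and> cell K s F (x U) \<subseteq> U" ..
  from bchoice[OF this] obtain F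
    where "\<forall>U\<in>\<F> - {{}}. F U \<in> Fpow I \<and> cell K s (F U) (x U) \<subseteq> U" ..
  then have xF: "F U \<in> Fpow I \<and> cell K s (F U) (x U) \<subseteq> U" if "U \<in> \<F> - {{}}" for U
    using that by (rule bspec)
  have "finite {U \<in> \<F> - {{}}. card (F U) = n}" (is "finite ?\<G>") for n
  proof (rule ccontr)
    assume "infinite ?\<G>"
    from infinite_arbitrarily_large[OF this, of "Suc (2 ^ n)"]
    obtain \<V> where \<V>: "\<V> \<subseteq> ?\<G>" "finite \<V>" "card \<V> = Suc (2 ^ n)"
      by (elim exE conjE)
    have "card \<V> \<le> 2 ^ n"
    proof (rule card_incompatible_le[where F = F and A = "\<lambda>U. s (x U)"])
      fix U V G
      assume UV: "U \<in> \<V>" "V \<in> \<V>" and G: "G \<subseteq> (\<Union>U\<in>\<V>. F U)"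
        and GU: "G \<inter> F U = s (x U) \<inter> F U" and GV: "G \<inter> F V = s (x V) \<inter> F V"
      have "(\<Union>U\<in>\<V>. F U) \<in> Fpow I"
        using xF \<V> by (fastforce simp: Fpow_def)
      from indep[OF this G] obtain y where "y \<in> K" and y: "s y \<inter> (\<Union>U\<in>\<V>. F U) = G"
        by blast
      have "s y \<inter> F U = G \<inter> F U" "s y \<inter> F V = G \<inter> F V"
        using y UV by blast+
      then have "y \<in> cell K s (F U) (x U)" "y \<in> cell K s (F V) (x V)"
        using \<open>y \<in> K\<close> GU GV by (auto simp: cell_def)
      then have "y \<in> U \<inter> V" using xF UV \<V>(1) by blast
      then show "U = V" using no UV \<V>(1) by blast
    qed (use \<V> xF in \<open>auto simp: Fpow_def\<close>)
    then show False using \<V> by simp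
  qed
  then have "countable (\<Union>n. {U \<in> \<F> - {{}}. card (F U) = n})"
    by (intro countable_UN) (auto intro: countable_finite)
  moreover have "\<F> \<subseteq> insert {} (\<Union>n. {U \<in> \<F> - {{}}. card (F U) = n})"
    by blast
  ultimately have "countable \<F>"
    by (meson countable_insert countable_subset)
  with unc show False ..
qed

section \<open>Making prescribed sets discrete\<close>

text \<open>
  The values of the coordinates at the point \<open>\<gamma>\<close>: those of the coordinates \<open>(\<alpha>, S)\<close> with
  \<open>\<gamma> = \<alpha>\<close> or \<open>\<gamma> \<in> S\<close> are forced, all others are read off from \<open>P \<gamma>\<close>.
\<close>
definition isolating_code :: "('a \<Rightarrow> ('a \<times> 'a set) set) \<Rightarrow> 'a \<Rightarrow> ('a \<times> 'a set) set"
  where "isolating_code P \<gamma> = {(\<alpha>, S). \<gamma> = \<alpha> \<or> (\<gamma> \<notin> S \<and> (\<alpha>, S) \<in> P \<gamma>)}"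

abbreviation isolating_topology ::
    "'a set \<Rightarrow> 'a set set \<Rightarrow> ('a \<Rightarrow> ('a \<times> 'a set) set) \<Rightarrow> 'a topology"
  where "isolating_topology K \<S> P \<equiv> code_topology K (isolating_code P) (K \<times> \<S>)"

lemma isolating_neighbourhood:
  assumes "\<alpha> \<in> K" "S \<in> \<S>"
  obtains A where "openin (isolating_topology K \<S> P) A" "openin (isolating_topology K \<S> P) (K - A)"
    "\<alpha> \<in> A" "A \<inter> S \<subseteq> {\<alpha>}"
proof
  let ?A = "{\<gamma>\<in>K. (\<alpha>, S) \<in> isolating_code P \<gamma>}"
  have "K - ?A = {\<gamma>\<in>K. (\<alpha>, S) \<notin> isolating_code P \<gamma>}" by blast
  then show "openin (isolating_topology K \<S> P) ?A"
    "openin (isolating_topology K \<S> P) (K - ?A)"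
    using openin_coordinate[of "(\<alpha>, S)" "K \<times> \<S>"] assms by auto
  show "\<alpha> \<in> ?A" "?A \<inter> S \<subseteq> {\<alpha>}"
    using assms by (auto simp: isolating_code_def)
qed

lemma not_ccc_isolating_subspace:
  assumes "Y \<subseteq> S" "S \<in> \<S>" "Y \<subseteq> K" "uncountable Y"
  shows "\<not> ccc_space (subtopology (isolating_topology K \<S> P) Y)"
proof
  assume ccc: "ccc_space (subtopology (isolating_topology K \<S> P) Y)"
  let ?\<F> = "(\<lambda>\<alpha>. {\<alpha>}) ` Y"
  have "openin (subtopology (isolating_topology K \<S> P) Y) {\<alpha>}" if "\<alpha> \<in> Y" for \<alpha>
  proof -
    have "\<alpha> \<in> K" using that assms by blast
    from this assms(2) obtain A where "openin (isolating_topology K \<S> P) A"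
      "\<alpha> \<in> A" "A \<inter> S \<subseteq> {\<alpha>}"
      by (rule isolating_neighbourhood)
    moreover from this have "{\<alpha>} = A \<inter> Y" using that assms by blast
    ultimately show ?thesis unfolding openin_subtopology by blast
  qed
  then have "\<forall>U\<in>?\<F>. openin (subtopology (isolating_topology K \<S> P) Y) U"
    by simp
  moreover have "uncountable ?\<F>"
    using assms(4) countable_image_inj_on[of "\<lambda>\<alpha>. {\<alpha>}" Y] by auto
  ultimately have "\<exists>U\<in>?\<F>. \<exists>V\<in>?\<F>. U \<noteq> V \<and> U \<inter> V \<noteq> {}"
    using ccc[unfolded ccc_space_def, rule_format, of ?\<F>] by simp
  then show False by auto
qed

lemma Hausdorff_isolating_topology:
  assumes "K \<subseteq> \<Union>\<S>"
  shows "Hausdorff_space (isolating_topology K \<S> P)"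
  unfolding Hausdorff_space_def
proof (intro allI impI)
  let ?X = "isolating_topology K \<S> P"
  fix x y assume xy: "x \<in> topspace ?X \<and> y \<in> topspace ?X \<and> x \<noteq> y"
  then obtain S where "S \<in> \<S>" "y \<in> S" "x \<in> K" "y \<in> K"
    using assms by auto
  then obtain A where "openin ?X A" "openin ?X (K - A)" "x \<in> A" "A \<inter> S \<subseteq> {x}"
    by (metis isolating_neighbourhood)
  moreover have "y \<in> K - A" using calculation xy \<open>y \<in> S\<close> \<open>y \<in> K\<close> by blast
  ultimately show "\<exists>U V. openin ?X U \<and> openin ?X V \<and> x \<in> U \<and> y \<in> V \<and> disjnt U V"
    by (metis Diff_disjoint disjnt_def)
qed

text \<open>
  For \<open>p \<in> K\<close> choose for every \<open>S \<in> \<D>\<close> a neighbourhood of \<open>p\<close> that meets \<open>S\<close> at most in \<open>p\<close>. As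
  \<open>\<D>\<close> covers \<open>K\<close>, the intersection of these neighbourhoods is \<open>{p}\<close>.
\<close>
lemma countable_pseudocharacter_isolating_topology:
  assumes "countable \<D>" "\<D> \<subseteq> \<S>" "K \<subseteq> \<Union>\<D>"
  shows "countable_pseudocharacter (isolating_topology K \<S> P)"
  unfolding countable_pseudocharacter_def
proof
  let ?X = "isolating_topology K \<S> P"
  fix p assume "p \<in> topspace ?X"
  then have p: "p \<in> K" by simp
  have "\<exists>A. openin ?X A \<and> p \<in> A \<and> A \<inter> S \<subseteq> {p}" if "S \<in> \<D>" for S
    using that p assms(2) isolating_neighbourhood by (metis subsetD)
  then obtain A where A: "\<And>S. S \<in> \<D> \<Longrightarrow> openin ?X (A S) \<and> p \<in> A S \<and> A S \<inter> S \<subseteq> {p}"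
    by metis
  have ne: "A ` \<D> \<noteq> {}" using p assms(3) by blast
  have sub: "A S \<subseteq> K" if "S \<in> \<D>" for S
    using A[OF that] openin_subset by fastforce
  have "y = p" if "y \<in> \<Inter>(A ` \<D>)" for y
  proof -
    have "y \<in> K" using that ne sub by blast
    then obtain S where "S \<in> \<D>" "y \<in> S" using assms(3) by blast
    then show ?thesis using that A[of S] by auto
  qed
  moreover have "p \<in> \<Inter>(A ` \<D>)" using A by simp
  ultimately have "{p} = \<Inter>(A ` \<D>)" by blast
  moreover have "gdelta_in ?X (\<Inter>(A ` \<D>))"
    using A ne assms(1) by (intro gdelta_in_Inter) (auto intro: open_imp_gdelta_in)
  ultimately show "gdelta_in ?X {p}" by simp
qed

text \<open>
  A point \<open>\<gamma>\<close> outside all \<open>S\<close> and different from all \<open>\<alpha>\<close> that occur in a finite set \<open>F\<close> of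
  coordinates has no forced values on \<open>F\<close>, so there its code is \<open>P \<gamma>\<close>. The richness of \<open>P\<close>
  therefore makes the codes dense.
\<close>
lemma ccc_isolating_topology:
  assumes rich: "\<And>G \<F> A. G \<in> Fpow (K \<times> \<S>) \<Longrightarrow> \<F> \<in> Fpow \<S> \<Longrightarrow> finite A \<Longrightarrow>
      \<exists>\<gamma>\<in>K - \<Union>\<F> - A. P \<gamma> = G"
  shows "ccc_space (isolating_topology K \<S> P)"
proof (rule ccc_code_topology)
  fix F G :: "('a \<times> 'a set) set"
  assume F: "F \<in> Fpow (K \<times> \<S>)" and "G \<subseteq> F"
  then have "G \<in> Fpow (K \<times> \<S>)" "snd ` F \<in> Fpow \<S>" "finite (fst ` F)"
    by (auto simp: Fpow_def intro: finite_subset)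
  from rich[OF this] obtain \<gamma> where "\<gamma> \<in> K" and P: "P \<gamma> = G"
    and new: "\<gamma> \<notin> \<Union>(snd ` F)" "\<gamma> \<notin> fst ` F"
    by blast
  have "(\<alpha>, S) \<in> isolating_code P \<gamma> \<longleftrightarrow> (\<alpha>, S) \<in> G" if "(\<alpha>, S) \<in> F" for \<alpha> S
    using that new P by (force simp: isolating_code_def)
  then have "isolating_code P \<gamma> \<inter> F = G"
    using \<open>G \<subseteq> F\<close> by auto
  then show "\<exists>\<gamma>\<in>K. isolating_code P \<gamma> \<inter> F = G"
    using \<open>\<gamma> \<in> K\<close> by blast
qed

section \<open>Regular cardinals\<close>

lemma card_of_finite_ordLess:
  assumes "Card_order r" "infinite (Field r)" "finite A"
  shows "|A| <o r"
proof (rule finite_ordLess_infinite)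
  show "Well_order r" using assms(1) by (rule card_order_on_well_order_on)
  show "Well_order |A|" by (rule card_of_Well_order)
qed (use assms in \<open>simp_all add: Field_card_of\<close>)

lemma card_of_Union_finite_ordLess:
  assumes "Card_order r" "infinite (Field r)" "finite \<F>" "\<And>S. S \<in> \<F> \<Longrightarrow> |S| <o r"
  shows "|\<Union>\<F>| <o r"
  using assms(3,4)
proof (induction \<F> rule: finite_induct)
  case empty
  show ?case
    using card_of_finite_ordLess[OF assms(1,2), of "{}"] by simp
next
  case (insert S \<F>)
  then show ?case
    using card_of_Un_ordLess_infinite_Field[OF assms(2,1), of S "\<Union>\<F>"] by simp
qed

lemma card_of_Fpow_ordLeq:
  assumes "infinite A"
  shows "|Fpow A| \<le>o |A|"
proof -
  have A: "A \<noteq> {}" using assms by auto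
  have *: "|{F \<in> Fpow A. card F = n}| \<le>o |A|" for n
  proof (induction n)
    case 0
    have "{F \<in> Fpow A. card F = 0} \<subseteq> (\<lambda>_. {}) ` A"
      using A by (auto simp: Fpow_def)
    then show ?case by (rule surj_imp_ordLeq)
  next
    case (Suc n)
    let ?T = "{F \<in> Fpow A. card F = n}"
    have "{F \<in> Fpow A. card F = Suc n} \<subseteq> (\<lambda>(a, F). insert a F) ` (A \<times> ?T)"
    proof
      fix F assume "F \<in> {F \<in> Fpow A. card F = Suc n}"
      then have F: "F \<subseteq> A" "finite F" "card F = Suc n" by (auto simp: Fpow_def)
      then obtain a G where aG: "F = insert a G" "a \<notin> G" "card G = n"
        by (auto simp: card_Suc_eq)
      then have "(a, G) \<in> A \<times> ?T" using F by (auto simp: Fpow_def)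
      then show "F \<in> (\<lambda>(a, F). insert a F) ` (A \<times> ?T)"
        using aG(1) by force
    qed
    then have "|{F \<in> Fpow A. card F = Suc n}| \<le>o |A \<times> ?T|" by (rule surj_imp_ordLeq)
    also have "|A \<times> ?T| \<le>o |A|"
    proof (cases "?T = {}")
      case True
      show ?thesis by (simp only: True Sigma_empty2 card_of_empty)
    next
      case False
      from card_of_Times_infinite[OF assms this Suc.IH] show ?thesis
        using ordIso_imp_ordLeq by blast
    qed
    finally show ?case .
  qed
  have "|\<Union>n. {F \<in> Fpow A. card F = n}| \<le>o |A|"
    by (rule card_of_UNION_ordLeq_infinite[OF assms])
      (use assms * in \<open>simp_all add: infinite_iff_card_of_nat[symmetric]\<close>)
  moreover have "(\<Union>n. {F \<in> Fpow A. card F = n}) = Fpow A" by blast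
  ultimately show ?thesis by simp
qed

text \<open>The projection of a bijection between \<open>K\<close> and \<open>K \<times> B\<close> has the required fibres.\<close>
lemma infinite_fibred_surjection:
  assumes "infinite K" "B \<noteq> {}" "|B| \<le>o |K|"
  shows "\<exists>f. f ` K = B \<and> (\<forall>b\<in>B. |{x\<in>K. f x = b}| =o |K| )"
proof -
  have "|K \<times> B| =o |K|"
    using card_of_Times_infinite[OF assms] by (rule conjunct1)
  then obtain h where h: "bij_betw h K (K \<times> B)"
    unfolding card_of_ordIso[symmetric] using bij_betw_inv by blast
  show ?thesis
  proof (intro exI[of _ "snd \<circ> h"] conjI ballI)
    have "K \<noteq> {}" using assms(1) by auto
    then have "snd ` h ` K = B" using h by (simp add: bij_betw_def)
    then show "(snd \<circ> h) ` K = B" by (simp only: image_comp)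
    fix b assume b: "b \<in> B"
    have "|K| \<le>o |{x\<in>K. (snd \<circ> h) x = b}|"
    proof (rule surj_imp_ordLeq)
      show "K \<subseteq> (fst \<circ> h) ` {x\<in>K. (snd \<circ> h) x = b}"
      proof
        fix a assume "a \<in> K"
        then have "(a, b) \<in> h ` K" using b h by (simp add: bij_betw_def)
        then obtain x where "x \<in> K" "h x = (a, b)" by (metis imageE)
        then show "a \<in> (fst \<circ> h) ` {x\<in>K. (snd \<circ> h) x = b}"
          by (intro image_eqI[of _ _ x]) simp_all
      qed
    qed
    moreover have "|{x\<in>K. (snd \<circ> h) x = b}| \<le>o |K|"
      by (rule card_of_mono1) blast
    ultimately show "|{x\<in>K. (snd \<circ> h) x = b}| =o |K|"
      using ordIso_iff_ordLeq by blast
  qed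
qed

lemma regular_small_subset_bounded:
  assumes "regular_cardinal \<kappa>" "Y \<subseteq> Field \<kappa>" "|Y| <o \<kappa>"
  obtains \<beta> where "\<beta> \<in> Field \<kappa>" "Y \<subseteq> under \<kappa> \<beta>"
proof -
  have co: "Card_order \<kappa>" and reg: "regularCard \<kappa>"
    using assms(1) by (auto simp: regular_cardinal_def)
  have wo: "wo_rel \<kappa>"
    using co by (simp add: card_order_on_well_order_on wo_rel_def)
  have "\<not> cofinal Y \<kappa>"
    using reg assms(2,3) not_ordLess_ordIso unfolding regularCard_def by blast
  then obtain \<beta> where \<beta>: "\<beta> \<in> Field \<kappa>" "\<And>b. b \<in> Y \<Longrightarrow> \<beta> = b \<or> (\<beta>, b) \<notin> \<kappa>"
    unfolding cofinal_def by blast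
  have "Y \<subseteq> under \<kappa> \<beta>"
  proof
    fix b assume "b \<in> Y"
    then have b: "\<beta> = b \<or> (\<beta>, b) \<notin> \<kappa>" "b \<in> Field \<kappa>"
      using \<beta>(2) assms(2) by auto
    have "(b, \<beta>) \<in> \<kappa>"
    proof (cases "\<beta> = b")
      case True
      then show ?thesis using wo_rel.REFL[OF wo] \<beta>(1) by (simp add: refl_onD)
    next
      case False
      then show ?thesis using wo_rel.TOTALS[OF wo] b \<beta>(1) by blast
    qed
    then show "b \<in> under \<kappa> \<beta>" by (simp add: under_def)
  qed
  with \<beta>(1) show thesis by (rule that)
qed

lemma card_of_under_ordLess:
  assumes "Card_order r" "infinite (Field r)" "a \<in> Field r"
  shows "|under r a| <o r"
proof -
  have "under r a \<subseteq> \<Union>{underS r a, {a}}"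
    by (auto simp: under_def underS_def)
  moreover have "|\<Union>{underS r a, {a}}| <o r"
  proof (rule card_of_Union_finite_ordLess)
    show "|S| <o r" if "S \<in> {underS r a, {a}}" for S
      using that card_of_underS[OF assms(1,3)] card_of_finite_ordLess[OF assms(1,2)] by auto
  qed (use assms in auto)
  ultimately show ?thesis
    using card_of_mono1 ordLeq_ordLess_trans by blast
qed

text \<open>
  A surjection \<open>f\<close> of \<open>K\<close> onto \<open>K \<times> nat\<close> with large fibres serves two purposes: its second
  component defines the partition into the sets \<open>D n\<close>, and its first component, read through an
  enumeration \<open>e\<close> of the finite sets of coordinates, defines \<open>P\<close>. The enumeration is chosen after
  \<open>\<S>\<close>, because the coordinates depend on the partition; this is why \<open>f\<close> does not map
  to the finite sets directly.
\<close>
lemma regular_rich_family: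
  fixes \<kappa> :: "'k rel"
  assumes "regular_cardinal \<kappa>"
  obtains \<S> \<D> :: "'k set set" and P
  where "countable \<D>" "\<D> \<subseteq> \<S>" "Field \<kappa> \<subseteq> \<Union>\<D>"
    and "\<And>Y. Y \<subseteq> Field \<kappa> \<Longrightarrow> |Y| <o \<kappa> \<Longrightarrow> \<exists>S\<in>\<S>. Y \<subseteq> S"
    and "\<And>G \<F> A. G \<in> Fpow (Field \<kappa> \<times> \<S>) \<Longrightarrow> \<F> \<in> Fpow \<S> \<Longrightarrow> finite A \<Longrightarrow>
          \<exists>\<gamma>\<in>Field \<kappa> - \<Union>\<F> - A. P \<gamma> = G"
proof -
  define K where "K = Field \<kappa>"
  have co: "Card_order \<kappa>" and inf: "infinite K"
    using assms by (auto simp: regular_cardinal_def cinfinite_def K_def)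
  have K\<kappa>: "|K| =o \<kappa>"
    using co K_def card_of_Field_ordIso by blast
  have nat: "|UNIV :: nat set| \<le>o |K|"
    using inf infinite_iff_card_of_nat by blast
  have "K \<times> (UNIV :: nat set) \<noteq> {}"
    using inf by auto
  moreover have "|K \<times> (UNIV :: nat set)| \<le>o |K|"
    using card_of_Times_infinite[OF inf _ nat] ordIso_imp_ordLeq by blast
  ultimately have "\<exists>f. f ` K = K \<times> (UNIV :: nat set) \<and>
      (\<forall>b\<in>K \<times> UNIV. |{x\<in>K. f x = b}| =o |K| )"
    by (rule infinite_fibred_surjection[OF inf])
  then obtain f :: "'k \<Rightarrow> 'k \<times> nat" where f: "f ` K = K \<times> UNIV"
    and fibre: "\<forall>b\<in>K \<times> UNIV. |{x\<in>K. f x = b}| =o |K|"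
    by (elim exE conjE)
  define D where "D n = {\<gamma>\<in>K. snd (f \<gamma>) = n}" for n
  define \<S> where "\<S> = under \<kappa> ` K \<union> range D"
  have "|\<S>| \<le>o |K|"
    unfolding \<S>_def
    using inf ordLeq_transitive[OF card_of_image nat]
    by (intro card_of_Un_ordLeq_infinite_Field)
      (simp_all add: Field_card_of card_of_image card_of_card_order_on)
  have \<S>_ne: "\<S> \<noteq> {}" unfolding \<S>_def by blast
  have K\<S>: "|K \<times> \<S>| =o |K|"
    using card_of_Times_infinite[OF inf \<S>_ne \<open>|\<S>| \<le>o |K|\<close>] by blast
  have inf': "infinite (K \<times> \<S>)"
    using inf \<S>_ne finite_cartesian_productD1 by blast
  have "|Fpow (K \<times> \<S>)| \<le>o |K|"
    using card_of_Fpow_ordLeq[OF inf'] K\<S> by (rule ordLeq_ordIso_trans)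
  with card_of_ordLeq2[OF Fpow_not_empty] have "\<exists>e. e ` K = Fpow (K \<times> \<S>)"
    by (rule iffD2)
  then obtain e where e: "e ` K = Fpow (K \<times> \<S>)" ..
  show ?thesis
  proof (rule that[of "range D" \<S> "\<lambda>\<gamma>. e (fst (f \<gamma>))"])
    show "Field \<kappa> \<subseteq> \<Union>(range D)" by (auto simp: D_def K_def)
    show "range D \<subseteq> \<S>" by (simp add: \<S>_def)
    show "\<exists>S\<in>\<S>. Y \<subseteq> S" if "Y \<subseteq> Field \<kappa>" "|Y| <o \<kappa>" for Y
      by (rule regular_small_subset_bounded[OF assms that]) (auto simp: \<S>_def K_def)
  next
    fix G \<F> A
    assume G: "G \<in> Fpow (Field \<kappa> \<times> \<S>)" and \<F>: "\<F> \<in> Fpow \<S>" and A: "finite (A :: 'k set)"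
    have "G \<in> e ` K" using e G by (simp add: K_def)
    then obtain \<delta> where \<delta>: "\<delta> \<in> K" "e \<delta> = G" by blast
    have D_ne: "\<exists>\<gamma>. \<gamma> \<in> D n" for n
    proof -
      have "(\<delta>, n) \<in> f ` K" using f \<delta> by simp
      then obtain \<gamma> where "\<gamma> \<in> K" "f \<gamma> = (\<delta>, n)" by (metis imageE)
      then have "\<gamma> \<in> D n" by (simp add: D_def)
      then show ?thesis by blast
    qed
    have "inj D"
    proof (rule injI)
      fix m n assume "D m = D n"
      with D_ne[of m] obtain \<gamma> where "\<gamma> \<in> D m" "\<gamma> \<in> D n" by blast
      then show "m = n" by (simp add: D_def)
    qed
    have "finite {n. D n \<in> \<F>}"
      using finite_vimageI[OF _ \<open>inj D\<close>, of \<F>] \<F> by (simp add: Fpow_def vimage_def)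
    from ex_new_if_finite[OF infinite_UNIV_nat this] obtain n where n: "D n \<notin> \<F>"
      by blast
    \<comment> \<open>The part of the excluded set that may meet \<open>D n\<close>; it is too small to contain a fibre of \<open>f\<close>.\<close>
    let ?\<U> = "{S\<in>\<F>. |S| <o \<kappa>} \<union> (\<lambda>a. {a}) ` A"
    have small_union: "|\<Union>?\<U>| <o \<kappa>"
    proof (rule card_of_Union_finite_ordLess[OF co])
      show "infinite (Field \<kappa>)" using inf K_def by simp
      show "finite ?\<U>" using \<F> A by (simp add: Fpow_def)
      show "|S| <o \<kappa>" if "S \<in> ?\<U>" for S
        using that inf card_of_finite_ordLess[OF co] by (auto simp: K_def)
    qed
    have "|{x\<in>K. f x = (\<delta>, n)}| =o |K|"
      using fibre \<delta>(1) by simp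
    then have "|{x\<in>K. f x = (\<delta>, n)}| =o \<kappa>"
      using K\<kappa> by (rule ordIso_transitive)
    then have "\<not> |{x\<in>K. f x = (\<delta>, n)}| <o \<kappa>"
      using not_ordLess_ordIso by blast
    then have "\<not> {x\<in>K. f x = (\<delta>, n)} \<subseteq> \<Union>?\<U>"
      using ordLeq_ordLess_trans[OF card_of_mono1 small_union] by blast
    then obtain \<gamma> where \<gamma>: "\<gamma> \<in> K" "f \<gamma> = (\<delta>, n)" "\<gamma> \<notin> \<Union>?\<U>"
      by blast
    have "\<gamma> \<notin> S" if "S \<in> \<F>" for S
    proof -
      have "S \<in> \<S>" using that \<F> by (auto simp: Fpow_def)
      then consider \<beta> where "\<beta> \<in> K" "S = under \<kappa> \<beta>" | m where "S = D m"
        unfolding \<S>_def by blast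
      then show ?thesis
      proof cases
        case 1
        then have "|S| <o \<kappa>"
          using card_of_under_ordLess[OF co] inf by (simp add: K_def)
        then show ?thesis using \<gamma>(3) that by blast
      next
        case 2
        then show ?thesis using n that \<gamma>(2) by (auto simp: D_def)
      qed
    qed
    then show "\<exists>\<gamma>\<in>Field \<kappa> - \<Union>\<F> - A. e (fst (f \<gamma>)) = G"
      using \<gamma> \<delta>(2) unfolding K_def by (intro bexI[of _ \<gamma>]) auto
  qed simp
qed

theorem mainTheorem3:
  fixes \<kappa> :: "'k rel"
  assumes "regular_cardinal \<kappa>"
  shows "\<exists>X :: 'k topology.
           ccc_space X \<and> tychonoff_space X \<and> |topspace X| =o \<kappa> \<and>
           countable_pseudocharacter X \<and>
           \<not> (\<exists>Y. Y \<subseteq> topspace X \<and> uncountable Y \<and> |Y| <o \<kappa> \<and>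
                  ccc_space (subtopology X Y))"
proof (rule regular_rich_family[OF assms])
  fix \<S> \<D> :: "'k set set" and P
  assume \<D>: "countable \<D>" "\<D> \<subseteq> \<S>" "Field \<kappa> \<subseteq> \<Union>\<D>"
    and small: "\<And>Y. Y \<subseteq> Field \<kappa> \<Longrightarrow> |Y| <o \<kappa> \<Longrightarrow> \<exists>S\<in>\<S>. Y \<subseteq> S"
    and rich: "\<And>G \<F> A. G \<in> Fpow (Field \<kappa> \<times> \<S>) \<Longrightarrow> \<F> \<in> Fpow \<S> \<Longrightarrow> finite A \<Longrightarrow>
      \<exists>\<gamma>\<in>Field \<kappa> - \<Union>\<F> - A. P \<gamma> = G"
  let ?X = "isolating_topology (Field \<kappa>) \<S> P"
  have "ccc_space ?X"
    using rich by (rule ccc_isolating_topology)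
  moreover have "tychonoff_space ?X"
    unfolding tychonoff_space_def
  proof (intro conjI completely_regular_code_topology Hausdorff_isolating_topology)
    show "Field \<kappa> \<subseteq> \<Union>\<S>" using \<D>(2,3) by blast
  qed
  moreover have "|topspace ?X| =o \<kappa>"
    using assms by (simp add: regular_cardinal_def card_of_Field_ordIso)
  moreover have "countable_pseudocharacter ?X"
    using \<D> by (rule countable_pseudocharacter_isolating_topology)
  moreover have "\<not> ccc_space (subtopology ?X Y)"
    if "Y \<subseteq> topspace ?X" "uncountable Y" "|Y| <o \<kappa>" for Y
  proof -
    have Y: "Y \<subseteq> Field \<kappa>" using that(1) by simp
    from small[OF this that(3)] obtain S where "S \<in> \<S>" "Y \<subseteq> S" ..
    from not_ccc_isolating_subspace[OF this(2,1) Y that(2)] show ?thesis .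
  qed
  ultimately show ?thesis by blast
qed

end
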